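(* Let $1<p<\infty$, and let $r_1,r_2\ge 0$ and $s_1,s_2>0$ be real numbers. Let $T_0:\ell_p\to\ell_p$ be the bounded linear operator given, for $x=\{x_n\}_{n\ge1}$ (with $x_{-1}=x_0=0$), by $(T_0x)_n=s_1x_{n-2}+r_1x_n+s_1x_{n+2}$ if $n$ is odd and $(T_0x)_n=s_2x_{n-2}+r_2x_n+s_2x_{n+2}$ if $n$ is even. Then the essential spectrum of $T_0$ over $\ell_p$ is $$\sigma_{ess}(T_0,\ell_p)=[r_1-2s_1,r_1+2s_1]\cup[r_2-2s_2,r_2+2s_2].$$
   Context: $\ell_p$ is the complex Banach space of $p$-summable sequences $x=\{x_n\}_{n\ge 1}$. An operator $A\in B(X)$ is Fredholm if its range $R(A)$ is closed and $\dim N(A)$ and $\dim (X/R(A))$ are finite. The essential spectrum is $\sigma_{ess}(A,X)=\{\lambda\in\mathbb{C}: A-\lambda I \text{ is not Fredholm}\}$. Intervals $[a,b]$ are closed intervals of the real line, viewed as subsets of $\mathbb{C}$. *)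

theory Defs
  imports "HOL-Analysis.Analysis" "HOL-Library.Function_Algebras"
begin

section \<open>Complex sequences and the spaces \<open>\<ell>\<^sub>p\<close>\<close>

definition seq_scale :: "complex \<Rightarrow> (nat \<Rightarrow> complex) \<Rightarrow> nat \<Rightarrow> complex"  (infixr \<open>*\<^sub>s\<^sub>q\<close> 75) where
  "c *\<^sub>s\<^sub>q x = (\<lambda>n. c * x n)"

global_interpretation cseq: vector_space seq_scale
  defines cseq_span = cseq.span
  by standard (auto simp: seq_scale_def fun_eq_iff algebra_simps)

text \<open>
  Sequences are indexed from \<open>1\<close>; the entry at index \<open>0\<close> is not part of the sequence and is
  fixed to be \<open>0\<close>.
\<close>

definition ell :: "real \<Rightarrow> (nat \<Rightarrow> complex) set" where
  "ell p = {x. x 0 = 0 \<and> summable (\<lambda>n. cmod (x n) powr p)}"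

definition ell_norm :: "real \<Rightarrow> (nat \<Rightarrow> complex) \<Rightarrow> real" where
  "ell_norm p x = (\<Sum>n. cmod (x n) powr p) powr (1 / p)"


section \<open>Fredholm operators and the essential spectrum\<close>

text \<open>
  The notions below are for a normed space of sequences with carrier \<open>X\<close> and norm \<open>N\<close>.
  Operators are functions on all sequences, of which only the values on \<open>X\<close> matter.
\<close>

definition bounded_operator ::
  "(nat \<Rightarrow> complex) set \<Rightarrow> ((nat \<Rightarrow> complex) \<Rightarrow> real) \<Rightarrow>
    ((nat \<Rightarrow> complex) \<Rightarrow> (nat \<Rightarrow> complex)) \<Rightarrow> bool" where
  "bounded_operator X N A \<longleftrightarrow>
     A ` X \<subseteq> X \<and>
     (\<forall>x\<in>X. \<forall>y\<in>X. A (x + y) = A x + A y) \<and>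
     (\<forall>c. \<forall>x\<in>X. A (c *\<^sub>s\<^sub>q x) = c *\<^sub>s\<^sub>q A x) \<and>
     (\<exists>K. \<forall>x\<in>X. N (A x) \<le> K * N x)"

definition norm_topology ::
  "(nat \<Rightarrow> complex) set \<Rightarrow> ((nat \<Rightarrow> complex) \<Rightarrow> real) \<Rightarrow> (nat \<Rightarrow> complex) topology" where
  "norm_topology X N = Metric_space.mtopology X (\<lambda>x y. N (x - y))"

definition null_space ::
  "(nat \<Rightarrow> complex) set \<Rightarrow> ((nat \<Rightarrow> complex) \<Rightarrow> (nat \<Rightarrow> complex)) \<Rightarrow> (nat \<Rightarrow> complex) set" where
  "null_space X A = {x \<in> X. A x = 0}"

definition finite_dimensional :: "(nat \<Rightarrow> complex) set \<Rightarrow> bool" where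
  "finite_dimensional V \<longleftrightarrow> (\<exists>B. finite B \<and> cseq_span B = V)"

definition coset_rel ::
  "(nat \<Rightarrow> complex) set \<Rightarrow> (nat \<Rightarrow> complex) set \<Rightarrow> ((nat \<Rightarrow> complex) \<times> (nat \<Rightarrow> complex)) set" where
  "coset_rel X R = {(x, y). x \<in> X \<and> y \<in> X \<and> x - y \<in> R}"

text \<open>
  \<open>X // coset_rel X R\<close> is the quotient space \<open>X / R\<close>. It is finite-dimensional if finitely many
  classes \<open>[b]\<close> span it; the linear combination \<open>\<Sum> c\<^sub>b [b]\<close> is the class of \<open>\<Sum> c\<^sub>b b\<close>.
\<close>

definition finite_dimensional_quotient ::
  "(nat \<Rightarrow> complex) set \<Rightarrow> (nat \<Rightarrow> complex) set \<Rightarrow> bool" where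
  "finite_dimensional_quotient X R \<longleftrightarrow>
     (\<exists>B. finite B \<and> B \<subseteq> X \<and>
       (\<forall>Q \<in> X // coset_rel X R. \<exists>c. Q = coset_rel X R `` {\<Sum>b\<in>B. c b *\<^sub>s\<^sub>q b}))"

definition fredholm ::
  "(nat \<Rightarrow> complex) set \<Rightarrow> ((nat \<Rightarrow> complex) \<Rightarrow> real) \<Rightarrow>
    ((nat \<Rightarrow> complex) \<Rightarrow> (nat \<Rightarrow> complex)) \<Rightarrow> bool" where
  "fredholm X N A \<longleftrightarrow>
     bounded_operator X N A \<and>
     closedin (norm_topology X N) (A ` X) \<and>
     finite_dimensional (null_space X A) \<and>
     finite_dimensional_quotient X (A ` X)"

definition ess_spectrum ::
  "(nat \<Rightarrow> complex) set \<Rightarrow> ((nat \<Rightarrow> complex) \<Rightarrow> real) \<Rightarrow>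
    ((nat \<Rightarrow> complex) \<Rightarrow> (nat \<Rightarrow> complex)) \<Rightarrow> complex set" where
  "ess_spectrum X N A = {l. \<not> fredholm X N (\<lambda>x. A x - l *\<^sub>s\<^sub>q x)}"


section \<open>The operator \<open>T\<^sub>0\<close>\<close>

text \<open>
  For \<open>n = 1\<close> the term \<open>x\<^sub>-\<^sub>1 = 0\<close> is rendered by the truncated \<open>x (1 - 2) = x 0\<close>, which is
  \<open>0\<close> for every \<open>x \<in> ell p\<close>. The case \<open>n = 0\<close> only keeps the unused entry equal to \<open>0\<close>.
\<close>

definition T0 :: "real \<Rightarrow> real \<Rightarrow> real \<Rightarrow> real \<Rightarrow> (nat \<Rightarrow> complex) \<Rightarrow> nat \<Rightarrow> complex" where
  "T0 r1 s1 r2 s2 x n =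
     (if n = 0 then 0
      else if odd n
      then of_real s1 * x (n - 2) + of_real r1 * x n + of_real s1 * x (n + 2)
      else of_real s2 * x (n - 2) + of_real r2 * x n + of_real s2 * x (n + 2))"


section \<open>\<open>\<ell>\<^sub>p\<close> is a normed space on which \<open>T\<^sub>0\<close> is bounded\<close>

lemma ell_norm_nonneg [simp]: "0 \<le> ell_norm p x"
  by (simp add: ell_norm_def)

lemma ell_norm_powr:
  assumes "x \<in> ell p" "p \<ge> 1"
  shows "ell_norm p x powr p = (\<Sum>n. cmod (x n) powr p)"
  using assms by (simp add: ell_norm_def powr_powr ell_def suminf_nonneg)

lemma ell_norm_eq_0:
  assumes "x \<in> ell p" "p \<ge> 1"
  shows "ell_norm p x = 0 \<longleftrightarrow> x = 0"
  using assms by (auto simp: ell_norm_def ell_def suminf_eq_zero_iff fun_eq_iff)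

lemma ell_mono:
  assumes x: "x \<in> ell p" and p: "p \<ge> 1" and le: "\<And>n. cmod (y n) \<le> cmod (x n)"
  shows "y \<in> ell p" "ell_norm p y \<le> ell_norm p x"
proof -
  have s: "summable (\<lambda>n. cmod (x n) powr p)" and x0: "x 0 = 0" using x by (auto simp: ell_def)
  have l: "cmod (y n) powr p \<le> cmod (x n) powr p" for n
    using p le by (intro powr_mono2) auto
  have s': "summable (\<lambda>n. cmod (y n) powr p)"
    by (rule summable_comparison_test'[OF s, of 0]) (use l in auto)
  show "y \<in> ell p" using s' le[of 0] x0 by (auto simp: ell_def)
  show "ell_norm p y \<le> ell_norm p x"
    unfolding ell_norm_def using p
    by (intro powr_mono2 suminf_le l s s' suminf_nonneg) auto
qed

lemma ell_zero [simp]: "0 \<in> ell p"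
  by (simp add: ell_def)

lemma ell_scale:
  assumes "x \<in> ell p" "p \<ge> 1"
  shows "c *\<^sub>s\<^sub>q x \<in> ell p" "ell_norm p (c *\<^sub>s\<^sub>q x) = cmod c * ell_norm p x"
  using assms
  by (auto simp: ell_def ell_norm_def seq_scale_def norm_mult powr_mult suminf_mult
      powr_powr suminf_nonneg summable_mult)

lemma powr_convex_nonneg:
  fixes u v t p :: real
  assumes "p \<ge> 1" "u \<ge> 0" "v \<ge> 0" "0 \<le> t" "t \<le> 1"
  shows "((1 - t) * u + t * v) powr p \<le> (1 - t) * u powr p + t * v powr p"
proof -
  have *: "(s * w) powr p \<le> s * w powr p" if "0 \<le> s" "s \<le> 1" "w \<ge> 0" for s w :: real
  proof -
    have "s powr p \<le> s"
      using that assms(1) powr_mono'[of 1 p s] by (cases "s = 0") auto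
    then show ?thesis using that by (simp add: powr_mult mult_right_mono)
  qed
  show ?thesis
  proof (cases "u = 0 \<or> v = 0")
    case True
    then show ?thesis using *[of "1 - t" u] *[of t v] assms by auto
  next
    case False
    then show ?thesis
      using convex_onD[OF powr_convex[OF assms(1)], of t u v] assms by simp
  qed
qed

lemma ell_add:
  assumes x: "x \<in> ell p" and y: "y \<in> ell p" and p: "p \<ge> 1"
  shows "x + y \<in> ell p" "ell_norm p (x + y) \<le> ell_norm p x + ell_norm p y"
proof -
  have "x + y \<in> ell p \<and> ell_norm p (x + y) \<le> ell_norm p x + ell_norm p y"
  proof (cases "x = 0 \<or> y = 0")
    case True
    then show ?thesis using x y by auto
  next
    case False
    define a b where "a = ell_norm p x" and "b = ell_norm p y"
    have ab: "a > 0" "b > 0"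
      using False ell_norm_eq_0[OF x p] ell_norm_eq_0[OF y p] ell_norm_nonneg[of p]
      by (auto simp: a_def b_def less_le)
    define t where "t = b / (a + b)"
    have t: "0 \<le> t" "t \<le> 1" "1 - t = a / (a + b)" using ab by (auto simp: t_def field_simps)
    let ?g = "\<lambda>n. (a + b) powr p * ((1 - t) * (cmod (x n) powr p / a powr p)
                    + t * (cmod (y n) powr p / b powr p))"
    have sx: "(\<lambda>n. cmod (x n) powr p) sums (a powr p)"
      using x ell_norm_powr[OF x p] by (simp add: a_def ell_def summable_sums)
    have sy: "(\<lambda>n. cmod (y n) powr p) sums (b powr p)"
      using y ell_norm_powr[OF y p] by (simp add: b_def ell_def summable_sums)
    have "?g sums ((a + b) powr p * ((1 - t) * (a powr p / a powr p) + t * (b powr p / b powr p)))"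
      by (intro sums_mult sums_add sums_divide sx sy)
    then have sg: "?g sums ((a + b) powr p)" using ab by simp
    have le: "cmod ((x + y) n) powr p \<le> ?g n" for n
    proof -
      have eq: "cmod (x n) + cmod (y n) = (a + b) * ((1 - t) * (cmod (x n) / a) + t * (cmod (y n) / b))"
      proof -
        have "(a + b) * (a / (a + b) * (u / a) + b / (a + b) * (v / b)) = u + v" for u v
          using ab by (simp add: distrib_left)
        then show ?thesis unfolding t(3) by (simp add: t_def)
      qed
      have "cmod ((x + y) n) powr p \<le> (cmod (x n) + cmod (y n)) powr p"
        using p by (intro powr_mono2) (auto simp: norm_triangle_ineq)
      also have "\<dots> = (a + b) powr p * ((1 - t) * (cmod (x n) / a) + t * (cmod (y n) / b)) powr p"
        unfolding eq using ab t by (subst powr_mult) auto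
      also have "\<dots> \<le> (a + b) powr p * ((1 - t) * (cmod (x n) / a) powr p + t * (cmod (y n) / b) powr p)"
        using ab t p by (intro mult_left_mono powr_convex_nonneg) auto
      finally show ?thesis using ab by (simp add: powr_divide)
    qed
    have sm: "summable (\<lambda>n. cmod ((x + y) n) powr p)"
      by (rule summable_comparison_test'[OF sums_summable[OF sg], of 0]) (use le in auto)
    have "(\<Sum>n. cmod ((x + y) n) powr p) \<le> (a + b) powr p"
      using suminf_le[OF le sm sums_summable[OF sg]] sums_unique[OF sg] by simp
    then have "ell_norm p (x + y) \<le> ((a + b) powr p) powr (1 / p)"
      unfolding ell_norm_def using p sm by (intro powr_mono2 suminf_nonneg) auto
    also have "\<dots> = a + b" using p ab by (simp add: powr_powr)
    finally show ?thesis using sm x y by (auto simp: a_def b_def ell_def)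
  qed
  then show "x + y \<in> ell p" "ell_norm p (x + y) \<le> ell_norm p x + ell_norm p y" by auto
qed

lemma ell_diff:
  assumes "x \<in> ell p" "y \<in> ell p" "p \<ge> 1"
  shows "x - y \<in> ell p"
proof -
  have "x - y = x + (-1) *\<^sub>s\<^sub>q y" by (auto simp: seq_scale_def fun_eq_iff)
  then show ?thesis using ell_add(1)[OF assms(1) ell_scale(1)[OF assms(2,3), of "-1"] assms(3)] by metis
qed

lemma Metric_space_ell:
  assumes p: "p \<ge> 1"
  shows "Metric_space (ell p) (\<lambda>x y. ell_norm p (x - y))"
proof
  show "0 \<le> ell_norm p (x - y)" for x y by simp
  show "ell_norm p (x - y) = ell_norm p (y - x)" for x y
    by (simp add: ell_norm_def norm_minus_commute)
  show "ell_norm p (x - y) = 0 \<longleftrightarrow> x = y" if "x \<in> ell p" "y \<in> ell p" for x y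
    using that p by (simp add: ell_norm_eq_0 ell_diff)
  show "ell_norm p (x - z) \<le> ell_norm p (x - y) + ell_norm p (y - z)"
    if "x \<in> ell p" "y \<in> ell p" "z \<in> ell p" for x y z
    using ell_add(2)[of "x - y" p "y - z"] that p by (simp add: ell_diff)
qed

lemma bounded_operator_T0:
  assumes p: "p \<ge> 1"
  shows "bounded_operator (ell p) (ell_norm p) (T0 r1 s1 r2 s2)"
proof -
  define C where "C = \<bar>r1\<bar> + \<bar>s1\<bar> + \<bar>r2\<bar> + \<bar>s2\<bar>"
  have C: "\<bar>r1\<bar> \<le> C" "\<bar>s1\<bar> \<le> C" "\<bar>r2\<bar> \<le> C" "\<bar>s2\<bar> \<le> C" by (auto simp: C_def)
  have C0: "0 \<le> C" using C(1) by linarith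
  have main: "T0 r1 s1 r2 s2 x \<in> ell p \<and> ell_norm p (T0 r1 s1 r2 s2 x) \<le> 3 * C * ell_norm p x"
    if x: "x \<in> ell p" for x
  proof -
    have x0: "x 0 = 0" and sx: "summable (\<lambda>n. cmod (x n) powr p)" using x by (auto simp: ell_def)
    define a where "a = (\<lambda>n. complex_of_real (cmod (x n)))"
    define l where "l = (\<lambda>n. if n = 0 then 0 else a (n - 2))"
    define r where "r = (\<lambda>n. if n = 0 then 0 else a (n + 2))"
    have a: "a \<in> ell p" "ell_norm p a \<le> ell_norm p x"
      using ell_mono[OF x p, of a] by (auto simp: a_def)
    have sl2: "(\<lambda>n. cmod (l (n + 2)) powr p) sums (\<Sum>n. cmod (x n) powr p)"
      using sx by (simp add: l_def a_def summable_sums)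
    have sl: "(\<lambda>n. cmod (l n) powr p) sums (\<Sum>n. cmod (x n) powr p)"
      using sums_iff_shift'[of "\<lambda>n. cmod (l n) powr p" 2 "\<Sum>n. cmod (x n) powr p"] sl2 x0
      by (simp add: l_def a_def numeral_2_eq_2)
    have l: "l \<in> ell p" "ell_norm p l \<le> ell_norm p x"
      using sl by (auto simp: ell_def sums_iff l_def ell_norm_def)
    have sr2: "summable (\<lambda>n. cmod (x (n + 2)) powr p)"
      using summable_ignore_initial_segment[OF sx] .
    have rle: "cmod (r n) powr p \<le> cmod (x (n + 2)) powr p" for n by (auto simp: r_def a_def)
    have sr: "summable (\<lambda>n. cmod (r n) powr p)"
      by (rule summable_comparison_test'[OF sr2, of 0]) (use rle in auto)
    have "(\<Sum>n. cmod (r n) powr p) \<le> (\<Sum>n. cmod (x (n + 2)) powr p)"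
      by (rule suminf_le[OF rle sr sr2])
    also have "\<dots> \<le> (\<Sum>n. cmod (x n) powr p)"
      using suminf_split_initial_segment[OF sx, of 2] by (simp add: sum_nonneg)
    finally have r: "r \<in> ell p" "ell_norm p r \<le> ell_norm p x"
      using sr p by (auto simp: ell_def r_def ell_norm_def intro!: powr_mono2 suminf_nonneg)
    define w where "w = complex_of_real C *\<^sub>s\<^sub>q (l + a + r)"
    have la: "l + a \<in> ell p" "l + a + r \<in> ell p" using l a r p by (auto intro: ell_add)
    have "ell_norm p (l + a + r) \<le> 3 * ell_norm p x"
      using ell_add(2)[OF la(1) r(1) p] ell_add(2)[OF l(1) a(1) p] l a r by linarith
    then have w: "w \<in> ell p" "ell_norm p w \<le> 3 * C * ell_norm p x"
      using la p C0 mult_left_mono[of "ell_norm p (l + a + r)" "3 * ell_norm p x" C]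
      by (auto simp: w_def ell_scale)
    have dom: "cmod (T0 r1 s1 r2 s2 x n) \<le> cmod (w n)" for n
    proof (cases "n = 0")
      case True
      then show ?thesis by (simp add: T0_def)
    next
      case False
      have "w n = of_real (C * (cmod (x (n - 2)) + cmod (x n) + cmod (x (n + 2))))"
        using False by (simp add: w_def seq_scale_def l_def r_def a_def)
      then have wn: "cmod (w n) = C * (cmod (x (n - 2)) + cmod (x n) + cmod (x (n + 2)))"
        using C0 by (simp only: norm_of_real) simp
      have bd: "cmod (of_real s * u + of_real r * v + of_real s * w) \<le> C * (cmod u + cmod v + cmod w)"
        if "\<bar>s\<bar> \<le> C" "\<bar>r\<bar> \<le> C" for s r :: real and u v w :: complex
      proof -
        have "cmod (of_real s * u + of_real r * v + of_real s * w)
            \<le> \<bar>s\<bar> * cmod u + \<bar>r\<bar> * cmod v + \<bar>s\<bar> * cmod w"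
          by (rule norm_triangle_le add_mono norm_triangle_le | simp add: norm_mult)+
        also have "\<dots> \<le> C * cmod u + C * cmod v + C * cmod w"
          using that by (intro add_mono mult_right_mono) auto
        finally show ?thesis by (simp add: algebra_simps)
      qed
      show ?thesis unfolding wn using False C by (auto simp: T0_def intro: bd)
    qed
    show ?thesis using ell_mono[OF w(1) p dom] w(2) by auto
  qed
  show ?thesis unfolding bounded_operator_def
  proof (intro conjI)
    show "\<exists>K. \<forall>x\<in>ell p. ell_norm p (T0 r1 s1 r2 s2 x) \<le> K * ell_norm p x"
      using main by blast
  qed (use main in \<open>auto simp: T0_def fun_eq_iff seq_scale_def algebra_simps\<close>)
qed

end

theory Submission
  imports Defs
begin

text \<open>
  The odd and even coordinates split \<open>T\<^sub>0 - l\<close> into two tridiagonal Toeplitz operators with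
  off-diagonal \<open>s = s\<^sub>j\<close> and diagonal \<open>c = r\<^sub>j - l\<close>. Let \<open>z\<close> be a root of \<open>s z\<^sup>2 + c z + s\<close>; the
  other root is \<open>1/z\<close>. If \<open>l\<close> lies in neither interval, then \<open>\<bar>z\<bar> < 1\<close> for a suitable root, and
  both operators factor into the invertible operators \<open>1 - z S\<^sup>*\<close> and \<open>1 - z S\<close>. If \<open>l\<close> lies in one
  of the intervals, then \<open>\<bar>z\<bar> = 1\<close>, and \<open>(z\<^sup>k)\<close> is a bounded solution of the adjoint
  recurrence, so summation by parts shows that \<open>\<Sum>k\<le>n. y\<^sub>k z\<^sup>k\<close> is bounded in \<open>n\<close> for every \<open>y\<close> in the
  range. The sequences \<open>z\<^sup>-\<^sup>k k\<^sup>-\<^sup>a\<close> with \<open>1/p < a \<le> 1\<close> lie in \<open>\<ell>\<^sub>p\<close>, and no nontrivial combination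
  of them has this property, so the range has infinite codimension.
\<close>

section \<open>Infinite codimension by unbounded partial sums\<close>

text \<open>Gaussian elimination, by induction on the equations \<open>B\<close>: an unknown
  \<open>i0\<close> that occurs in equation \<open>b\<close> is solved for there and substituted
  into the others. This removes one equation and one unknown.\<close>

lemma homogeneous_system_nontrivial_solution:
  fixes c :: "'i \<Rightarrow> 'b \<Rightarrow> 'a::field"
  assumes "finite B" "finite I" "card B < card I"
  shows "\<exists>d. (\<exists>i\<in>I. d i \<noteq> 0) \<and> (\<forall>b\<in>B. (\<Sum>i\<in>I. d i * c i b) = 0)"
  using assms
proof (induction B arbitrary: I c rule: finite_induct)
  case empty
  then show ?case by (intro exI[of _ "\<lambda>_. 1"]) (auto simp: card_gt_0_iff)
next
  case (insert b B)
  show ?case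
  proof (cases "\<forall>i\<in>I. c i b = 0")
    case True
    have "card B < card I" using insert.prems insert.hyps by simp
    then obtain d where "\<exists>i\<in>I. d i \<noteq> 0" "\<forall>b\<in>B. (\<Sum>i\<in>I. d i * c i b) = 0"
      using insert.IH[of I c] insert.prems(1) by blast
    then show ?thesis using True by (intro exI[of _ d]) auto
  next
    case False
    then obtain i0 where i0: "i0 \<in> I" "c i0 b \<noteq> 0" by auto
    define J where "J = I - {i0}"
    have J: "finite J" "i0 \<notin> J" "I = insert i0 J" "card B < card J"
      using insert.prems insert.hyps i0 by (auto simp: J_def card_insert_if)
    obtain d where d: "\<exists>i\<in>J. d i \<noteq> 0"
      "\<forall>b'\<in>B. (\<Sum>i\<in>J. d i * (c i b' - c i b / c i0 b * c i0 b')) = 0"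
      using insert.IH[OF J(1,4), of "\<lambda>i b'. c i b' - c i b / c i0 b * c i0 b'"] by blast
    define D where "D = d(i0 := - (\<Sum>i\<in>J. d i * (c i b / c i0 b)))"
    have D: "(\<Sum>i\<in>I. D i * c i b') = (\<Sum>i\<in>J. d i * (c i b' - c i b / c i0 b * c i0 b'))" for b'
    proof -
      have "(\<Sum>i\<in>J. D i * c i b') = (\<Sum>i\<in>J. d i * c i b')"
        using J by (intro sum.cong) (auto simp: D_def)
      then show ?thesis using J
        by (simp add: D_def sum_distrib_left sum_distrib_right algebra_simps sum_subtractf)
    qed
    have "\<exists>i\<in>I. D i \<noteq> 0" using d(1) J by (auto simp: D_def)
    moreover have "(\<Sum>i\<in>I. D i * c i b) = 0" using i0 by (simp add: D)
    ultimately show ?thesis using d(2) by (intro exI[of _ D]) (auto simp: D)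
  qed
qed

text \<open>Modulo \<open>R\<close>, every \<open>v i\<close> is a combination of the finitely many
  spanning vectors \<open>b\<close>. Some nontrivial combination of \<open>card B + 1\<close> of the
  \<open>v i\<close> cancels the coefficient of each \<open>b\<close>. What remains is a combination
  of the differences, which lie in \<open>R\<close>, where each difference has its own bound on the
  \<open>F n\<close>.\<close>

lemma finite_dimensional_quotient_bounded_combination:
  assumes fd: "finite_dimensional_quotient X R"
    and "0 \<in> R"
    and v: "\<And>i. v i \<in> X"
    and add: "\<And>n x y. F n (x + y) = F n x + F n y"
    and scale: "\<And>n c x. F n (c *\<^sub>s\<^sub>q x) = c * F n x"
    and bdd: "\<And>x. x \<in> R \<Longrightarrow> \<exists>M. \<forall>n. cmod (F n x) \<le> M"
  shows "\<exists>(N::nat) d M. (\<exists>i\<le>N. d i \<noteq> 0) \<and> (\<forall>n. cmod (\<Sum>i\<le>N. d i * F n (v i)) \<le> M)"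
proof -
  have F0: "F n 0 = 0" for n using add[of n 0 0] by simp
  have Fdiff: "F n (x - y) = F n x - F n y" for n x y using add[of n "x - y" y] by simp
  have Fsum: "F n (\<Sum>b\<in>B. g b) = (\<Sum>b\<in>B. F n (g b))" if "finite B" for n and g :: "(nat \<Rightarrow> complex) \<Rightarrow> _" and B
    using that by (induction B rule: finite_induct) (simp_all only: sum.empty F0 sum.insert add finite.emptyI not_False_eq_True)
  obtain B where B: "finite B"
    "\<And>Q. Q \<in> X // coset_rel X R \<Longrightarrow> \<exists>c. Q = coset_rel X R `` {\<Sum>b\<in>B. c b *\<^sub>s\<^sub>q b}"
    using fd by (auto simp: finite_dimensional_quotient_def)
  have "\<exists>c. (\<Sum>b\<in>B. c b *\<^sub>s\<^sub>q b) - v i \<in> R" for i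
  proof -
    obtain c where c: "coset_rel X R `` {v i} = coset_rel X R `` {\<Sum>b\<in>B. c b *\<^sub>s\<^sub>q b}"
      using B(2)[of "coset_rel X R `` {v i}"] v[of i] by (auto simp: quotient_def)
    have "v i \<in> coset_rel X R `` {v i}" using v[of i] \<open>0 \<in> R\<close> by (simp add: coset_rel_def)
    then show ?thesis unfolding c by (auto simp: coset_rel_def)
  qed
  then obtain c where c: "\<And>i. (\<Sum>b\<in>B. c i b *\<^sub>s\<^sub>q b) - v i \<in> R" by metis
  obtain M where M: "\<And>i n. cmod (F n ((\<Sum>b\<in>B. c i b *\<^sub>s\<^sub>q b) - v i)) \<le> M i"
    using bdd[OF c] by metis
  define N where "N = card B"
  \<comment> \<open>The index set \<open>{..N}\<close> has \<open>card B + 1\<close> elements, one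
    more unknown than there are equations.\<close>
  obtain d where d: "\<exists>i\<in>{..N}. d i \<noteq> 0" "\<forall>b\<in>B. (\<Sum>i\<le>N. d i * c i b) = 0"
    using homogeneous_system_nontrivial_solution[of B "{..N}" c] B(1) by (auto simp: N_def)
  have "cmod (\<Sum>i\<le>N. d i * F n (v i)) \<le> (\<Sum>i\<le>N. cmod (d i) * M i)" for n
  proof -
    have "(\<Sum>i\<le>N. d i * (\<Sum>b\<in>B. c i b * F n b)) = (\<Sum>b\<in>B. (\<Sum>i\<le>N. d i * c i b) * F n b)"
      unfolding sum_distrib_left sum_distrib_right by (subst sum.swap) (simp add: mult.assoc)
    also have "\<dots> = 0" using d(2) by simp
    finally have "(\<Sum>i\<le>N. d i * F n (v i)) = - (\<Sum>i\<le>N. d i * F n ((\<Sum>b\<in>B. c i b *\<^sub>s\<^sub>q b) - v i))"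
      by (simp add: Fdiff Fsum[OF B(1)] scale right_diff_distrib sum_subtractf)
    then have "cmod (\<Sum>i\<le>N. d i * F n (v i)) = cmod (\<Sum>i\<le>N. d i * F n ((\<Sum>b\<in>B. c i b *\<^sub>s\<^sub>q b) - v i))"
      by simp
    also have "\<dots> \<le> (\<Sum>i\<le>N. cmod (d i) * M i)"
      by (intro sum_norm_le) (simp add: norm_mult M mult_left_mono)
    finally show ?thesis .
  qed
  moreover have "\<exists>i\<le>N. d i \<noteq> 0" using d(1) by auto
  ultimately show ?thesis by blast
qed

text \<open>Since \<open>a\<close> decreases, the largest index \<open>m\<close> with
  \<open>d m\<close> nonzero carries the smallest exponent, and this term dominates for large
  \<open>k\<close>. As \<open>a m \<le> 1\<close>, it decays no faster than \<open>1 / k\<close>, so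
  bounded partial sums would make the harmonic series converge.\<close>

lemma partial_sums_powr_combination_unbounded:
  fixes a :: "nat \<Rightarrow> real" and d :: "nat \<Rightarrow> complex"
  assumes a: "strict_antimono_on UNIV a" "\<And>i. a i \<le> 1"
    and d: "\<exists>i\<le>N. d i \<noteq> 0"
    and M: "\<And>n. cmod (\<Sum>k=1..n. \<Sum>i\<le>N. d i * of_real (real k powr - a i)) \<le> M"
  shows False
proof -
  define m where "m = (GREATEST i. i \<le> N \<and> d i \<noteq> 0)"
  have ex: "\<exists>i. i \<le> N \<and> d i \<noteq> 0" using d by blast
  have m: "m \<le> N" "d m \<noteq> 0"
    using GreatestI_ex_nat[OF ex, of N] by (auto simp: m_def)
  have big: "d i = 0" if "i \<le> N" "m < i" for i
    using Greatest_le_nat[of "\<lambda>i. i \<le> N \<and> d i \<noteq> 0" i N] that by (fastforce simp: m_def)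
  define f where "f k = (\<Sum>i\<le>N. d i * of_real (real k powr - a i))" for k
  \<comment> \<open>Multiplication by \<open>cnj (d m)\<close> turns the leading coefficient into
    the positive number \<open>(cmod (d m))\<^sup>2\<close>, so that the real parts can be bounded
    below.\<close>
  define g where "g k = Re (cnj (d m) * f k)" for k
  have lim: "(\<lambda>k. d i * of_real (real k powr (a m - a i))) \<longlonglongrightarrow> (if i = m then d m else 0)"
    if "i \<le> N" for i
  proof -
    consider "i = m" | "i > m" | "i < m" by linarith
    then show ?thesis
    proof cases
      case 1
      then show ?thesis
        by (auto intro!: tendsto_eventually eventually_sequentiallyI[of 1])
    next
      case 2
      then show ?thesis using big that by simp
    next
      case 3
      then have "a m - a i < 0" using a(1) by (auto simp: monotone_on_def)
      then have "(\<lambda>k. real k powr (a m - a i)) \<longlonglongrightarrow> 0"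
        by (intro tendsto_neg_powr filterlim_real_sequentially)
      then have "(\<lambda>k. d i * of_real (real k powr (a m - a i))) \<longlonglongrightarrow> d i * of_real 0"
        by (intro tendsto_intros)
      then show ?thesis using 3 by simp
    qed
  qed
  have "(\<lambda>k. \<Sum>i\<le>N. d i * of_real (real k powr (a m - a i))) \<longlonglongrightarrow> (\<Sum>i\<le>N. if i = m then d m else 0)"
    by (intro tendsto_sum lim) auto
  then have "(\<lambda>k. \<Sum>i\<le>N. d i * of_real (real k powr (a m - a i))) \<longlonglongrightarrow> d m"
    using m by simp
  then have "(\<lambda>k. Re (cnj (d m) * (\<Sum>i\<le>N. d i * of_real (real k powr (a m - a i))))) \<longlonglongrightarrow> Re (cnj (d m) * d m)"
    by (intro tendsto_intros)
  moreover have c: "Re (cnj (d m) * d m) = (cmod (d m))\<^sup>2"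
    by (metis Re_complex_of_real complex_norm_square mult.commute)
  define q where "q = (cmod (d m))\<^sup>2 / 2"
  have q: "q > 0" "q < Re (cnj (d m) * d m)" using m unfolding c by (auto simp: q_def)
  ultimately have "\<forall>\<^sub>F k in sequentially. q < Re (cnj (d m) * (\<Sum>i\<le>N. d i * of_real (real k powr (a m - a i))))"
    by (intro order_tendstoD) auto
  then have "\<forall>\<^sub>F k in sequentially. q / real k \<le> g k"
    using eventually_ge_at_top[of 1]
  proof eventually_elim
    case (elim k)
    have fk: "f k = of_real (real k powr (- a m)) * (\<Sum>i\<le>N. d i * of_real (real k powr (a m - a i)))"
      unfolding f_def sum_distrib_left
      by (intro sum.cong refl) (simp add: powr_diff powr_minus field_simps elim)
    have "g k = real k powr (- a m) * Re (cnj (d m) * (\<Sum>i\<le>N. d i * of_real (real k powr (a m - a i))))"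
      unfolding g_def fk by (simp add: algebra_simps)
    moreover have "real k powr (- 1) * q \<le> \<dots>"
      using elim a(2)[of m] q by (intro mult_mono powr_mono) auto
    ultimately have "real k powr (- 1) * q \<le> g k" by simp
    then show ?case by (simp add: powr_minus divide_inverse mult.commute)
  qed
  then obtain K where K: "\<And>k. k \<ge> K \<Longrightarrow> q / real k \<le> g k"
    by (auto simp: eventually_sequentially)
  have gs: "\<bar>\<Sum>k=1..n. g k\<bar> \<le> cmod (d m) * M" for n
  proof -
    have "(\<Sum>k=1..n. g k) = Re (cnj (d m) * (\<Sum>k=1..n. f k))"
      by (simp add: g_def sum_distrib_left)
    also have "\<bar>\<dots>\<bar> \<le> cmod (cnj (d m) * (\<Sum>k=1..n. f k))" by (rule abs_Re_le_cmod)
    also have "\<dots> \<le> cmod (d m) * M"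
      using M[of n] by (simp add: norm_mult f_def mult_left_mono)
    finally show ?thesis .
  qed
  \<comment> \<open>The tail from \<open>L\<close> on is a difference of two partial sums starting
    at 1, hence the factor 2 in the bound below.\<close>
  define L where "L = Suc K"
  have "summable (\<lambda>k. q / real (k + L))"
  proof (rule bounded_imp_summable[where B = "2 * (cmod (d m) * M)"])
    show "0 \<le> q / real (k + L)" for k using q by simp
    show "(\<Sum>k\<le>n. q / real (k + L)) \<le> 2 * (cmod (d m) * M)" for n
    proof -
      have "(\<Sum>k\<le>n. q / real (k + L)) \<le> (\<Sum>k\<le>n. g (k + L))"
        by (intro sum_mono K) (simp add: L_def)
      also have "\<dots> = (\<Sum>k=L..n+L. g k)"
        by (simp add: atMost_atLeast0 flip: sum.shift_bounds_cl_nat_ivl)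
      also have "\<dots> = (\<Sum>k=1..n+L. g k) - (\<Sum>k=1..K. g k)"
      proof -
        have "{1..n+L} = {1..K} \<union> {L..n+L}" by (auto simp: L_def)
        moreover have "(\<Sum>k\<in>{1..K} \<union> {L..n+L}. g k) = (\<Sum>k=1..K. g k) + (\<Sum>k=L..n+L. g k)"
          by (intro sum.union_disjoint) (auto simp: L_def)
        ultimately show ?thesis by simp
      qed
      also have "\<dots> \<le> 2 * (cmod (d m) * M)" using gs[of "n+L"] gs[of K] by linarith
      finally show ?thesis .
    qed
  qed
  then have "summable (\<lambda>k. q / real k)" by (subst (asm) summable_iff_shift[of "\<lambda>k. q / real k"])
  then have "summable (\<lambda>k. (1/q) * (q / real k))" by (rule summable_mult)
  then have "summable (\<lambda>k. inverse (real k))" using q by (simp add: field_simps)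
  then show False using not_summable_harmonic[where 'a = real] by (simp add: inverse_eq_divide)
qed

section \<open>The tridiagonal operators\<close>

definition tridiag :: "complex \<Rightarrow> complex \<Rightarrow> (nat \<Rightarrow> complex) \<Rightarrow> nat \<Rightarrow> complex" where
  "tridiag s c x k = (if k = 0 then 0 else s * x (k - 1) + c * x k + s * x (k + 1))"

lemma ell_bounded:
  assumes "x \<in> ell p" "p \<ge> 1"
  shows "cmod (x n) \<le> ell_norm p x"
proof -
  have "cmod (x n) powr p \<le> (\<Sum>k. cmod (x k) powr p)"
    using sum_le_suminf[of "\<lambda>k. cmod (x k) powr p" "{n}"] assms by (auto simp: ell_def)
  then have "(cmod (x n) powr p) powr (1/p) \<le> ell_norm p x"
    unfolding ell_norm_def using assms by (intro powr_mono2) auto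
  then show ?thesis using assms by (simp add: powr_powr)
qed

section \<open>Summation by parts against the powers of a root\<close>

text \<open>In the interior the coefficient of each \<open>x k\<close> is a power of \<zeta> times
  the characteristic polynomial, so it vanishes. Only boundary terms survive; \<open>s * x 1\<close>
  appears because the powers of \<zeta> take the value 1, not 0, at index 0.\<close>

lemma tridiag_partial_sums:
  assumes "s * \<zeta>\<^sup>2 + c * \<zeta> + s = 0" "x 0 = 0"
  shows "(\<Sum>k=1..n. tridiag s c x k * \<zeta> ^ k) = s * (x (n+1) * \<zeta> ^ n - x n * \<zeta> ^ (n+1)) - s * x 1"
proof (induction n)
  case 0
  then show ?case using assms by simp
next
  case (Suc n)
  have "c * \<zeta> = (s * \<zeta>\<^sup>2 + c * \<zeta> + s) - s * \<zeta>\<^sup>2 - s" by simp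
  then have "c * \<zeta> = - s * \<zeta>\<^sup>2 - s" unfolding assms(1) by simp
  moreover have "tridiag s c x (Suc n) * \<zeta> ^ Suc n
      = s * x n * \<zeta> ^ Suc n + c * \<zeta> * (x (n + 1) * \<zeta> ^ n) + s * x (n + 2) * \<zeta> ^ Suc n"
    by (simp add: tridiag_def algebra_simps)
  ultimately have "tridiag s c x (Suc n) * \<zeta> ^ Suc n
      = s * x n * \<zeta> ^ Suc n + (- s * \<zeta>\<^sup>2 - s) * (x (n + 1) * \<zeta> ^ n) + s * x (n + 2) * \<zeta> ^ Suc n"
    by simp
  moreover have "(\<Sum>k=1..Suc n. tridiag s c x k * \<zeta> ^ k)
      = (\<Sum>k=1..n. tridiag s c x k * \<zeta> ^ k) + tridiag s c x (Suc n) * \<zeta> ^ Suc n"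
    by simp
  ultimately show ?case unfolding Suc.IH by (simp only:) (simp add: algebra_simps power2_eq_square)
qed

lemma tridiag_partial_sums_bounded:
  assumes "s * \<zeta>\<^sup>2 + c * \<zeta> + s = 0" "cmod \<zeta> = 1" "x \<in> ell p" "p \<ge> 1"
  shows "\<exists>M. \<forall>n. cmod (\<Sum>k=1..n. tridiag s c x k * \<zeta> ^ k) \<le> M"
proof (intro exI allI)
  fix n
  let ?N = "ell_norm p x"
  have b: "cmod (x k) \<le> ?N" for k using ell_bounded assms by blast
  have "cmod (\<Sum>k=1..n. tridiag s c x k * \<zeta> ^ k) = cmod (s * (x (n+1) * \<zeta> ^ n - x n * \<zeta> ^ (n+1) - x 1))"
    using assms by (subst tridiag_partial_sums) (auto simp: ell_def algebra_simps)
  also have "\<dots> \<le> cmod s * (?N + ?N + ?N)"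
    unfolding norm_mult
  proof (intro mult_left_mono)
    have "cmod (x (n+1) * \<zeta> ^ n - x n * \<zeta> ^ (n+1) - x 1)
      \<le> cmod (x (n+1) * \<zeta> ^ n) + cmod (x n * \<zeta> ^ (n+1)) + cmod (x 1)"
      by (meson add_right_mono norm_triangle_ineq4 order_trans)
    also have "\<dots> = cmod (x (n+1)) + cmod (x n) + cmod (x 1)"
      using assms(2) by (simp add: norm_mult norm_power del: power_Suc)
    also have "\<dots> \<le> ?N + ?N + ?N" by (intro add_mono b)
    finally show "cmod (x (n+1) * \<zeta> ^ n - x n * \<zeta> ^ (n+1) - x 1) \<le> ?N + ?N + ?N" .
  qed auto
  finally show "cmod (\<Sum>k=1..n. tridiag s c x k * \<zeta> ^ k) \<le> cmod s * (?N + ?N + ?N)" .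
qed

section \<open>Inversion of the tridiagonal operator for a root inside the unit disc\<close>

text \<open>
  With \<open>S\<close> the right shift and \<open>S\<^sup>*\<close> the left shift, \<open>S\<^sup>* S = 1\<close> gives
  \<open>(1 - z S\<^sup>*) (1 - z S) = (1 + z\<^sup>2) - z (S + S\<^sup>*)\<close>, a multiple of the tridiagonal operator when
  \<open>z\<close> is a root of \<open>s z\<^sup>2 + c z + s\<close>.
\<close>

lemma tridiag_factor:
  fixes x :: "nat \<Rightarrow> complex"
  assumes "s * z\<^sup>2 + c * z + s = 0" "k \<ge> 1"
  defines "v \<equiv> \<lambda>k. x k - z * x (k - 1)"
  shows "z * tridiag s c x k = - s * (v k - z * v (k + 1))"
proof -
  have "c * z = (s * z\<^sup>2 + c * z + s) - s * z\<^sup>2 - s" by simp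
  then have "c * z = - s * z\<^sup>2 - s" unfolding assms(1) by simp
  moreover have "z * tridiag s c x k = z * s * x (k - 1) + c * z * x k + z * s * x (k + 1)"
    using assms(2) by (simp add: tridiag_def algebra_simps)
  ultimately show ?thesis
    by (simp only:) (simp add: v_def algebra_simps power2_eq_square)
qed

text \<open>By the factorization, \<open>v\<close> satisfies \<open>v k = z ^ n * v (k + n)\<close>
  for all \<open>n\<close>. Since \<open>v\<close> is bounded and \<open>cmod z < 1\<close>, it
  vanishes from index 1 on. Then \<open>x\<close> is a geometric sequence starting from
  \<open>x 0 = 0\<close>.\<close>

lemma tridiag_inj:
  assumes z: "s * z\<^sup>2 + c * z + s = 0" "cmod z < 1" "s \<noteq> 0"
    and x: "x \<in> ell p" "p \<ge> 1" and 0: "tridiag s c x = 0"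
  shows "x = 0"
proof -
  define v where "v = (\<lambda>k. x k - z * x (k - 1))"
  have step: "v k = z * v (k + 1)" if "k \<ge> 1" for k
    using tridiag_factor[OF z(1) that, of x] 0 z(3) by (simp add: v_def)
  have iter: "v k = z ^ n * v (k + n)" if "k \<ge> 1" for k n
  proof (induction n)
    case (Suc n)
    then show ?case using step[of "k + n"] that by simp
  qed simp
  have "v k = 0" if "k \<ge> 1" for k
  proof -
    let ?M = "ell_norm p x"
    have b: "cmod (v j) \<le> ?M + ?M" for j
    proof -
      have "cmod (v j) \<le> cmod (x j) + cmod z * cmod (x (j - 1))"
        unfolding v_def by (metis norm_mult norm_triangle_ineq4)
      also have "\<dots> \<le> ?M + 1 * ?M"
        using z(2) ell_bounded[OF x] by (intro add_mono mult_mono) auto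
      finally show ?thesis by simp
    qed
    have "cmod (v k) \<le> cmod z ^ n * (?M + ?M)" for n
      using b[of "k + n"] iter[OF that, of n] by (simp add: norm_mult norm_power mult_left_mono)
    moreover have "(\<lambda>n. cmod z ^ n * (?M + ?M)) \<longlonglongrightarrow> 0 * (?M + ?M)"
      using z(2) by (intro tendsto_intros LIMSEQ_power_zero) auto
    ultimately have "cmod (v k) \<le> 0 * (?M + ?M)" by (intro LIMSEQ_le_const) auto
    then show ?thesis by simp
  qed
  then have v: "x (Suc k) = z * x k" for k by (force simp: v_def dest: meta_spec[of _ "Suc k"])
  have "x k = 0" for k
    by (induction k) (use x v in \<open>auto simp: ell_def\<close>)
  then show ?thesis by (simp add: fun_eq_iff)
qed

text \<open>Convexity of the power, with weights \<rho> and \<open>1 - \<rho>\<close> at the points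
  \<open>u\<close> and \<open>v / (1 - \<rho>)\<close>. The point of this form is that
  \<open>u powr p\<close> gets a factor below 1 and can later be absorbed.\<close>

lemma powr_add_le:
  fixes \<rho> u v p :: real
  assumes "p \<ge> 1" "0 \<le> \<rho>" "\<rho> < 1" "u \<ge> 0" "v \<ge> 0"
  shows "(\<rho> * u + v) powr p \<le> \<rho> * u powr p + (1 - \<rho>) * (1 / (1 - \<rho>)) powr p * v powr p"
  using powr_convex_nonneg[of p u "v / (1 - \<rho>)" "1 - \<rho>"] assms
  by (simp add: powr_divide)

text \<open>This inverts the factor with the right shift. Summing the one-step estimate puts the
  partial sum of \<open>cmod (x k) powr p\<close> on both sides, with factor \<rho> on the right;
  absorbing it leaves a bound independent of \<open>n\<close>.\<close>

lemma ell_forward_recursion: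
  assumes u: "u \<in> ell p" "p \<ge> 1" and z: "cmod z < 1"
    and x: "x 0 = 0" "\<And>k. x (Suc k) = z * x k + u (Suc k)"
  shows "x \<in> ell p"
proof -
  define \<rho> where "\<rho> = cmod z"
  define C where "C = (1 - \<rho>) * (1 / (1 - \<rho>)) powr p"
  have \<rho>: "0 \<le> \<rho>" "\<rho> < 1" and C: "C \<ge> 0" using z by (auto simp: \<rho>_def C_def)
  define U where "U = (\<Sum>k. cmod (u k) powr p)"
  have step: "cmod (x (Suc k)) powr p \<le> \<rho> * cmod (x k) powr p + C * cmod (u (Suc k)) powr p" for k
  proof -
    have "cmod (x (Suc k)) \<le> \<rho> * cmod (x k) + cmod (u (Suc k))"
      unfolding x(2) \<rho>_def by (metis norm_mult norm_triangle_ineq)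
    then have "cmod (x (Suc k)) powr p \<le> (\<rho> * cmod (x k) + cmod (u (Suc k))) powr p"
      using u(2) by (intro powr_mono2) auto
    also have "\<dots> \<le> \<rho> * cmod (x k) powr p + C * cmod (u (Suc k)) powr p"
      unfolding C_def using u(2) \<rho> by (intro powr_add_le) auto
    finally show ?thesis .
  qed
  have "(1 - \<rho>) * (\<Sum>k\<le>n. cmod (x k) powr p) \<le> C * U" for n
  proof -
    have "(\<Sum>k\<le>n. cmod (x k) powr p) \<le> (\<Sum>k\<le>Suc n. cmod (x k) powr p)" by simp
    also have "\<dots> = (\<Sum>k\<le>n. cmod (x (Suc k)) powr p)"
      by (subst sum.atMost_Suc_shift) (simp add: x(1))
    also have "\<dots> \<le> \<rho> * (\<Sum>k\<le>n. cmod (x k) powr p) + C * (\<Sum>k\<le>n. cmod (u (Suc k)) powr p)"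
      unfolding sum_distrib_left sum.distrib[symmetric] by (intro sum_mono step)
    also have "(\<Sum>k\<le>n. cmod (u (Suc k)) powr p) = (\<Sum>k\<le>Suc n. cmod (u k) powr p)"
      using u by (subst sum.atMost_Suc_shift) (simp add: ell_def)
    also have "C * \<dots> \<le> C * U" unfolding U_def
      using u C by (intro mult_left_mono sum_le_suminf) (auto simp: ell_def)
    finally show ?thesis by (simp add: algebra_simps)
  qed
  then have "(\<Sum>k\<le>n. cmod (x k) powr p) \<le> C * U / (1 - \<rho>)" for n
    using \<rho> by (simp add: field_simps)
  then have "summable (\<lambda>k. cmod (x k) powr p)" by (intro bounded_imp_summable) auto
  then show ?thesis using x(1) by (simp add: ell_def)
qed

text \<open>This inverts the factor with the left shift by its Neumann series, which converges
  because the entries of \<open>y\<close> are bounded. Membership in \<open>ell p\<close> follows by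
  absorption as in the forward case.\<close>

lemma ell_backward_recursion:
  assumes y: "y \<in> ell p" "p \<ge> 1" and z: "cmod z < 1"
  shows "\<exists>u\<in>ell p. \<forall>k\<ge>1. u k - z * u (k + 1) = y k"
proof -
  define \<rho> where "\<rho> = cmod z"
  define C where "C = (1 - \<rho>) * (1 / (1 - \<rho>)) powr p"
  have \<rho>: "0 \<le> \<rho>" "\<rho> < 1" and C: "C \<ge> 0" using z by (auto simp: \<rho>_def C_def)
  define Y where "Y = (\<Sum>k. cmod (y k) powr p)"
  define u where "u k = (\<Sum>n. z ^ n * y (k + n))" for k
  let ?N = "ell_norm p y"
  have geo: "summable (\<lambda>n. \<rho> ^ n * ?N)"
    using \<rho> by (intro summable_mult2 summable_geometric) auto
  have le: "cmod (z ^ n * y (k + n)) \<le> \<rho> ^ n * ?N" for k n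
    using ell_bounded[OF y] by (simp add: norm_mult norm_power \<rho>_def mult_left_mono)
  have sm: "summable (\<lambda>n. z ^ n * y (k + n))" for k
    by (rule summable_comparison_test'[OF geo, of 0]) (use le in auto)
  \<comment> \<open>The recursion now refers to \<open>u (k + 1)\<close>, so the shifted partial sum
    contains one extra term at \<open>n + 1\<close>. The uniform bound \<open>M\<close> controls
    that term.\<close>
  define M where "M = (\<Sum>n. \<rho> ^ n * ?N)"
  have u_bdd: "cmod (u k) \<le> M" for k
    unfolding u_def M_def by (intro norm_suminf_le le geo)
  have u_rec: "u k = z * u (k + 1) + y k" for k
    using suminf_split_head[OF sm, of k] suminf_mult[OF sm, of z "k + 1"]
    by (simp add: u_def mult.assoc diff_eq_eq)
  have step: "cmod (u k) powr p \<le> \<rho> * cmod (u (Suc k)) powr p + C * cmod (y k) powr p" for k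
  proof -
    have "cmod (u k) \<le> \<rho> * cmod (u (Suc k)) + cmod (y k)"
      unfolding \<rho>_def using norm_triangle_ineq[of "z * u (k + 1)" "y k"]
      by (simp add: u_rec[of k] norm_mult)
    then have "cmod (u k) powr p \<le> (\<rho> * cmod (u (Suc k)) + cmod (y k)) powr p"
      using y(2) by (intro powr_mono2) auto
    also have "\<dots> \<le> \<rho> * cmod (u (Suc k)) powr p + C * cmod (y k) powr p"
      unfolding C_def using y(2) \<rho> by (intro powr_add_le) auto
    finally show ?thesis .
  qed
  have "(1 - \<rho>) * (\<Sum>k\<le>n. cmod (u k) powr p) \<le> M powr p + C * Y" for n
  proof -
    have "(\<Sum>k\<le>n. cmod (u k) powr p)
        \<le> \<rho> * (\<Sum>k\<le>n. cmod (u (Suc k)) powr p) + C * (\<Sum>k\<le>n. cmod (y k) powr p)"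
      unfolding sum_distrib_left sum.distrib[symmetric] by (intro sum_mono step)
    also have "\<dots> \<le> \<rho> * ((\<Sum>k\<le>n. cmod (u k) powr p) + M powr p) + C * Y"
    proof (intro add_mono mult_left_mono)
      have "(\<Sum>k\<le>n. cmod (u (Suc k)) powr p) \<le> (\<Sum>k\<le>Suc n. cmod (u k) powr p)"
        by (subst sum.atMost_Suc_shift) simp
      also have "\<dots> \<le> (\<Sum>k\<le>n. cmod (u k) powr p) + M powr p"
        using y(2) u_bdd by (auto intro!: powr_mono2)
      finally show "(\<Sum>k\<le>n. cmod (u (Suc k)) powr p) \<le> (\<Sum>k\<le>n. cmod (u k) powr p) + M powr p" .
      show "(\<Sum>k\<le>n. cmod (y k) powr p) \<le> Y" unfolding Y_def
        using y by (intro sum_le_suminf) (auto simp: ell_def)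
    qed (use \<rho> C in auto)
    also have "\<rho> * M powr p \<le> 1 * M powr p" using \<rho> by (intro mult_right_mono) auto
    then have "\<rho> * ((\<Sum>k\<le>n. cmod (u k) powr p) + M powr p) + C * Y
      \<le> \<rho> * (\<Sum>k\<le>n. cmod (u k) powr p) + M powr p + C * Y" by (simp add: algebra_simps)
    finally show ?thesis by (simp add: algebra_simps)
  qed
  then have "(\<Sum>k\<le>n. cmod (u k) powr p) \<le> (M powr p + C * Y) / (1 - \<rho>)" for n
    using \<rho> by (simp add: field_simps)
  then have su: "summable (\<lambda>k. cmod (u k) powr p)" by (intro bounded_imp_summable) auto
  \<comment> \<open>The series may give a nonzero value at index 0. It can be reset, since the
    recursion is required only from index 1 on.\<close>
  define u' where "u' k = (if k = 0 then 0 else u k)" for k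
  have "summable (\<lambda>k. cmod (u' k) powr p)"
    by (rule summable_comparison_test'[OF su, of 0]) (auto simp: u'_def)
  then have "u' \<in> ell p" by (simp add: ell_def u'_def)
  moreover have "u' k - z * u' (k + 1) = y k" if "k \<ge> 1" for k
    using that u_rec[of k] by (simp add: u'_def)
  ultimately show ?thesis by blast
qed

text \<open>The two factors are inverted in turn: the backward recursion yields \<open>u\<close>,
  then the forward recursion yields \<open>x\<close>. The scaling \<open>- z / s\<close> of the
  right-hand side is the constant from \<open>tridiag_factor\<close>.\<close>

lemma tridiag_surj:
  assumes z: "s * z\<^sup>2 + c * z + s = 0" "cmod z < 1" "s \<noteq> 0"
    and y: "y \<in> ell p" "p \<ge> 1"
  shows "\<exists>x\<in>ell p. tridiag s c x = y"
proof -
  \<comment> \<open>At \<open>z = 0\<close> the characteristic equation would read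
    \<open>s = 0\<close>.\<close>
  have "z \<noteq> 0" using z by auto
  obtain u where u: "u \<in> ell p" "\<And>k. k \<ge> 1 \<Longrightarrow> u k - z * u (k + 1) = ((- z / s) *\<^sub>s\<^sub>q y) k"
    using ell_backward_recursion[OF ell_scale(1)[OF y] y(2) z(2)] by blast
  define x where "x = rec_nat 0 (\<lambda>k r. z * r + u (Suc k))"
  have x: "x 0 = 0" "\<And>k. x (Suc k) = z * x k + u (Suc k)" by (auto simp: x_def)
  have "x \<in> ell p" by (rule ell_forward_recursion[OF u(1) y(2) z(2) x])
  moreover have "tridiag s c x k = y k" for k
  proof (cases k)
    case 0
    then show ?thesis using y by (simp add: tridiag_def ell_def)
  next
    case (Suc j)
    have v: "x k - z * x (k - 1) = u k" if "k \<ge> 1" for k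
      using that x(2)[of "k - 1"] by simp
    have "z * tridiag s c x k = - s * (u k - z * u (k + 1))"
      using tridiag_factor[OF z(1), of k x] v[of k] v[of "k + 1"] Suc by simp
    also have "\<dots> = z * y k" using u(2)[of k] Suc z(3) by (simp add: seq_scale_def)
    finally show ?thesis using \<open>z \<noteq> 0\<close> by simp
  qed
  ultimately show ?thesis by (auto simp: fun_eq_iff)
qed

section \<open>Location of the characteristic roots\<close>

text \<open>The two roots have product 1, so one lies inside the unit disc unless both lie on the
  circle. In that case they are conjugate with sum \<open>2 * Re z1\<close>, which forces
  \<open>l = r + 2 * s * Re z1\<close> into the interval.\<close>

lemma characteristic_root_outside:
  fixes s r :: real and l :: complex
  assumes "s > 0" and l: "l \<notin> complex_of_real ` {r - 2 * s .. r + 2 * s}"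
  shows "\<exists>z::complex. s * z\<^sup>2 + (r - l) * z + s = 0 \<and> cmod z < 1"
proof -
  define w where "w = (l - r) / s"
  define q where "q = csqrt (w\<^sup>2 - 4)"
  define z1 z2 where "z1 = (w + q) / 2" and "z2 = (w - q) / 2"
  have q: "q * q = w * w - 4" by (metis q_def power2_csqrt power2_eq_square)
  have sum: "z1 + z2 = w" by (simp add: z1_def z2_def field_simps)
  have prod: "z1 * z2 = 1" using q by (simp add: z1_def z2_def algebra_simps)
  have root: "s * z\<^sup>2 + (r - l) * z + s = 0" if "z = z1 \<or> z = z2" for z :: complex
  proof -
    have "z\<^sup>2 - w * z + 1 = 0"
      unfolding sum[symmetric] using prod that by (auto simp: algebra_simps power2_eq_square)
    then have "s * (z\<^sup>2 - w * z + 1) = 0" by simp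
    then have "s * z\<^sup>2 + - (s * w) * z + s = 0" by (simp add: algebra_simps)
    moreover have "- (s * w) = r - l" using assms(1) by (simp add: w_def)
    ultimately show ?thesis by simp
  qed
  have "cmod z1 \<noteq> 1"
  proof
    assume 1: "cmod z1 = 1"
    have "z1 * cnj z1 = 1" using 1 by (simp add: complex_norm_square[symmetric])
    then have "z2 = cnj z1" using prod 1 by (metis mult_left_cancel mult_zero_left zero_neq_one)
    then have w: "w = of_real (2 * Re z1)" using sum complex_add_cnj by metis
    have "\<bar>Re z1\<bar> \<le> 1" using abs_Re_le_cmod[of z1] 1 by simp
    moreover have "l = of_real (r + s * (2 * Re z1))"
      using w assms(1) by (simp add: w_def field_simps)
    ultimately show False using l assms(1)
      by (auto simp: image_iff abs_le_iff dest!: bspec[where x = "r + s * (2 * Re z1)"])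
        (smt (verit) mult_left_le mult_minus_right)+
  qed
  moreover have "cmod z1 * cmod z2 = 1" using prod by (metis norm_mult norm_one)
  ultimately have "cmod z1 < 1 \<or> cmod z2 < 1"
    by (metis less_eq_real_def linorder_not_less mult_le_cancel_left1 norm_ge_zero mult_strict_mono' mult_1 zero_le_one)
  then show ?thesis using root by blast
qed

text \<open>The interval is parametrized by \<open>t = r + 2 * s * cos \<theta>\<close>, and the
  root is the point of the unit circle with angle \<theta>.\<close>

lemma characteristic_root_inside:
  fixes s r t :: real
  assumes "s > 0" and t: "t \<in> {r - 2 * s .. r + 2 * s}"
  shows "\<exists>z::complex. s * z\<^sup>2 + (r - complex_of_real t) * z + s = 0 \<and> cmod z = 1"
proof -
  define h where "h = (t - r) / (2 * s)"
  have h: "- 1 \<le> h" "h \<le> 1" using assms by (auto simp: h_def field_simps)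
  define z where "z = cis (arccos h)"
  have "z + cnj z = of_real (2 * h)" using h by (simp add: z_def complex_add_cnj)
  then have "s * (z + cnj z) = of_real (s * (2 * h))" by simp
  moreover have "s * (2 * h) = t - r" using assms(1) by (simp add: h_def)
  ultimately have sr: "s * (z + cnj z) = t - r" by simp
  have "z * cnj z = 1" by (simp add: z_def cis_cnj cis_mult)
  then have "s * z\<^sup>2 + s = s * (z + cnj z) * z"
    by (simp add: algebra_simps power2_eq_square)
  then have "s * z\<^sup>2 + - (s * (z + cnj z)) * z + s = 0"
    by (simp add: algebra_simps)
  then have "s * z\<^sup>2 + (r - complex_of_real t) * z + s = 0"
    unfolding sr by simp
  moreover have "cmod z = 1" by (simp add: z_def)
  ultimately show ?thesis by blast
qed

section \<open>Splitting into even and odd indices\<close>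

text \<open>
  Here \<open>d = 1\<close> selects the odd and \<open>d = 0\<close> the even indices. Both parts are indexed from \<open>1\<close>
  again, and for \<open>k = 0\<close> truncated subtraction makes \<open>2 * k - d\<close> the unused index \<open>0\<close>.
\<close>

definition parity_part :: "nat \<Rightarrow> (nat \<Rightarrow> complex) \<Rightarrow> nat \<Rightarrow> complex" where
  "parity_part d x k = x (2 * k - d)"

definition parity_spread :: "nat \<Rightarrow> (nat \<Rightarrow> complex) \<Rightarrow> nat \<Rightarrow> complex" where
  "parity_spread d u n = (if even (n + d) then u ((n + d) div 2) else 0)"

lemma parity_part_ell:
  assumes "x \<in> ell p" "d \<le> 1"
  shows "parity_part d x \<in> ell p"
proof -
  have "inj (\<lambda>k. 2 * k - d)" using assms(2) by (auto simp: inj_def le_Suc_eq)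
  then have "summable ((\<lambda>n. cmod (x n) powr p) \<circ> (\<lambda>k. 2 * k - d))"
    using assms(1) by (intro summable_reindex) (auto simp: ell_def)
  then show ?thesis using assms(1) by (simp add: ell_def parity_part_def o_def)
qed

lemma parity_part_spread:
  assumes "d \<le> 1" "d' \<le> 1" "u 0 = 0"
  shows "parity_part d' (parity_spread d u) = (if d' = d then u else 0)"
proof
  fix k
  show "parity_part d' (parity_spread d u) k = (if d' = d then u else 0) k"
    using assms by (cases k) (auto simp: parity_part_def parity_spread_def le_Suc_eq)
qed

lemma parity_spread_ell:
  assumes "u \<in> ell p" "d \<le> 1"
  shows "parity_spread d u \<in> ell p"
proof -
  have u0: "u 0 = 0" using assms(1) by (simp add: ell_def)
  have "strict_mono (\<lambda>k. 2 * k - d)" using assms(2) by (auto simp: strict_mono_def le_Suc_eq)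
  moreover have "cmod (parity_spread d u n) powr p = 0" if "n \<notin> range (\<lambda>k. 2 * k - d)" for n
  proof -
    have "odd (n + d)"
    proof
      assume "even (n + d)"
      then have "n = 2 * ((n + d) div 2) - d" by simp
      then show False using that by blast
    qed
    then show ?thesis by (simp add: parity_spread_def)
  qed
  ultimately have "summable (\<lambda>k. cmod (parity_spread d u (2 * k - d)) powr p)
      \<longleftrightarrow> summable (\<lambda>n. cmod (parity_spread d u n) powr p)"
    by (rule summable_mono_reindex)
  moreover have "parity_spread d u (2 * k - d) = u k" for k
    using fun_cong[OF parity_part_spread[of d d u, OF assms(2) assms(2) u0], of k]
    by (simp add: parity_part_def)
  ultimately show ?thesis
    using assms u0 by (auto simp: ell_def parity_spread_def le_Suc_eq)
qed

lemma parity_part_eqI: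
  assumes "\<And>d. d \<le> 1 \<Longrightarrow> parity_part d x = parity_part d y"
  shows "x = y"
proof
  fix n
  show "x n = y n"
  proof (cases "even n")
    case True
    then show ?thesis
      using fun_cong[OF assms[of 0], of "n div 2"] by (simp add: parity_part_def)
  next
    case False
    then show ?thesis
      using fun_cong[OF assms[of 1], of "(n + 1) div 2"] by (auto simp: parity_part_def elim: oddE)
  qed
qed

lemma parity_part_T0:
  assumes "x 0 = 0" "d \<le> 1"
  shows "parity_part d (T0 r1 s1 r2 s2 x - l *\<^sub>s\<^sub>q x) =
    tridiag (of_real (if d = 1 then s1 else s2)) (of_real (if d = 1 then r1 else r2) - l) (parity_part d x)"
proof
  fix k
  show "parity_part d (T0 r1 s1 r2 s2 x - l *\<^sub>s\<^sub>q x) k =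
    tridiag (of_real (if d = 1 then s1 else s2)) (of_real (if d = 1 then r1 else r2) - l) (parity_part d x) k"
  proof (cases k)
    case 0
    then show ?thesis using assms by (simp add: parity_part_def T0_def tridiag_def seq_scale_def)
  next
    case (Suc j)
    consider "d = 0" | "d = 1" using assms(2) by linarith
    then show ?thesis
    proof cases
      case 1
      then show ?thesis using Suc
        by (simp add: parity_part_def T0_def tridiag_def seq_scale_def algebra_simps)
    next
      case 2
      \<comment> \<open>The case \<open>j = 0\<close> concerns index 1, whose left neighbour is
        truncated to index 0 on both sides.\<close>
      then show ?thesis using Suc assms(1)
        by (cases j) (simp_all add: parity_part_def T0_def tridiag_def seq_scale_def algebra_simps)
    qed
  qed
qed

section \<open>The essential spectrum\<close>

lemma bounded_operator_diff_scale:
  assumes A: "bounded_operator (ell p) (ell_norm p) A" and p: "p \<ge> 1"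
  shows "bounded_operator (ell p) (ell_norm p) (\<lambda>x. A x - l *\<^sub>s\<^sub>q x)"
proof -
  obtain K where K: "\<And>x. x \<in> ell p \<Longrightarrow> ell_norm p (A x) \<le> K * ell_norm p x"
    using A unfolding bounded_operator_def by blast
  have cl: "A x \<in> ell p" if "x \<in> ell p" for x using A that by (auto simp: bounded_operator_def)
  have eq: "A x - l *\<^sub>s\<^sub>q x = A x + (- l) *\<^sub>s\<^sub>q x" for x
    by (simp add: seq_scale_def fun_eq_iff)
  have "ell_norm p (A x - l *\<^sub>s\<^sub>q x) \<le> (K + cmod l) * ell_norm p x" if x: "x \<in> ell p" for x
  proof -
    have "ell_norm p (A x - l *\<^sub>s\<^sub>q x) \<le> ell_norm p (A x) + ell_norm p ((- l) *\<^sub>s\<^sub>q x)"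
      unfolding eq using cl x p by (intro ell_add ell_scale) auto
    also have "\<dots> \<le> K * ell_norm p x + cmod l * ell_norm p x"
      using K[OF x] ell_scale(2)[OF x p, of "- l"] by simp
    finally show ?thesis by (simp add: algebra_simps)
  qed
  then have "\<exists>K. \<forall>x\<in>ell p. ell_norm p (A x - l *\<^sub>s\<^sub>q x) \<le> K * ell_norm p x" by blast
  moreover have "A x - l *\<^sub>s\<^sub>q x \<in> ell p" if "x \<in> ell p" for x
    using cl that p by (intro ell_diff ell_scale)
  moreover have "A (x + y) - l *\<^sub>s\<^sub>q (x + y) = (A x - l *\<^sub>s\<^sub>q x) + (A y - l *\<^sub>s\<^sub>q y)"
    if "x \<in> ell p" "y \<in> ell p" for x y
  proof -
    have "A (x + y) = A x + A y" using A that by (simp add: bounded_operator_def)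
    then show ?thesis by (simp add: seq_scale_def fun_eq_iff algebra_simps)
  qed
  moreover have "A (c *\<^sub>s\<^sub>q x) - l *\<^sub>s\<^sub>q c *\<^sub>s\<^sub>q x = c *\<^sub>s\<^sub>q (A x - l *\<^sub>s\<^sub>q x)" if "x \<in> ell p" for c x
  proof -
    have "A (c *\<^sub>s\<^sub>q x) = c *\<^sub>s\<^sub>q A x" using A that by (simp add: bounded_operator_def)
    then show ?thesis by (simp add: seq_scale_def fun_eq_iff algebra_simps)
  qed
  ultimately show ?thesis unfolding bounded_operator_def by blast
qed

lemma fredholm_bijective:
  assumes p: "p \<ge> 1" and A: "bounded_operator (ell p) (ell_norm p) A"
    and inj: "\<And>x. x \<in> ell p \<Longrightarrow> A x = 0 \<Longrightarrow> x = 0"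
    and surj: "\<And>y. y \<in> ell p \<Longrightarrow> \<exists>x\<in>ell p. A x = y"
  shows "fredholm (ell p) (ell_norm p) A"
proof -
  interpret Metric_space "ell p" "\<lambda>x y. ell_norm p (x - y)" by (rule Metric_space_ell[OF p])
  have "A ` ell p \<subseteq> ell p" using A by (simp add: bounded_operator_def)
  moreover have "ell p \<subseteq> A ` ell p"
  proof
    fix y assume "y \<in> ell p"
    then show "y \<in> A ` ell p" using surj[of y] by blast
  qed
  ultimately have range: "A ` ell p = ell p" by (rule equalityI)
  have "A (0 *\<^sub>s\<^sub>q 0) = 0 *\<^sub>s\<^sub>q A 0" using A ell_zero[of p] unfolding bounded_operator_def by blast
  then have "A 0 = 0" by (simp only: cseq.scale_zero_left)
  then have "null_space (ell p) A = {0}" using inj unfolding null_space_def by (blast intro: ell_zero)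
  then have "finite_dimensional (null_space (ell p) A)"
    unfolding finite_dimensional_def by (metis cseq.span_empty finite.emptyI)
  moreover have "finite_dimensional_quotient (ell p) (ell p)"
  proof -
    have "coset_rel (ell p) (ell p) `` {x} = ell p" if "x \<in> ell p" for x
      using that p unfolding coset_rel_def by (blast intro: ell_diff)
    \<comment> \<open>The quotient has a single class, that of 0, so the empty set with its empty
      sum spans it.\<close>
    then show ?thesis
      unfolding finite_dimensional_quotient_def quotient_def
      by (intro exI[of _ "{}"]) (simp only: sum.empty ell_zero finite.emptyI empty_subsetI, blast)
  qed
  moreover have "closedin (norm_topology (ell p) (ell_norm p)) (ell p)"
    unfolding norm_topology_def using closedin_topspace[of mtopology] by simp
  ultimately show ?thesis using A by (simp add: fredholm_def range)
qed

lemma T0_fredholm: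
  assumes p: "p \<ge> 1" and s: "s1 > 0" "s2 > 0"
    and l: "l \<notin> complex_of_real ` {r1 - 2 * s1 .. r1 + 2 * s1}"
      "l \<notin> complex_of_real ` {r2 - 2 * s2 .. r2 + 2 * s2}"
  shows "fredholm (ell p) (ell_norm p) (\<lambda>x. T0 r1 s1 r2 s2 x - l *\<^sub>s\<^sub>q x)"
proof (rule fredholm_bijective[OF p])
  let ?A = "\<lambda>x. T0 r1 s1 r2 s2 x - l *\<^sub>s\<^sub>q x"
  let ?s = "\<lambda>d::nat. if d = 1 then s1 else s2" and ?r = "\<lambda>d::nat. if d = 1 then r1 else r2"
  have "\<exists>z::complex. ?s d * z\<^sup>2 + (?r d - l) * z + ?s d = 0 \<and> cmod z < 1" for d
    using characteristic_root_outside[OF s(1) l(1)] characteristic_root_outside[OF s(2) l(2)] by simp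
  then obtain z :: "nat \<Rightarrow> complex" where
    z: "\<And>d. ?s d * (z d)\<^sup>2 + (?r d - l) * z d + ?s d = 0" "\<And>d. cmod (z d) < 1"
    by metis
  have sn: "complex_of_real (?s d) \<noteq> 0" for d using s by simp
  show "bounded_operator (ell p) (ell_norm p) ?A"
    by (intro bounded_operator_diff_scale bounded_operator_T0 p)
  show "x = 0" if x: "x \<in> ell p" and "?A x = 0" for x
  proof (rule parity_part_eqI)
    fix d :: nat assume d: "d \<le> 1"
    have "parity_part d (?A x) = 0" using that by (simp add: parity_part_def fun_eq_iff)
    then have "tridiag (?s d) (?r d - l) (parity_part d x) = 0"
      using parity_part_T0[of x d r1 s1 r2 s2 l] x d by (simp add: ell_def)
    then have "parity_part d x = 0"
      by (rule tridiag_inj[OF z(1) z(2) sn parity_part_ell[OF x d] p])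
    then show "parity_part d x = parity_part d 0" by (simp add: parity_part_def fun_eq_iff)
  qed
  show "\<exists>x\<in>ell p. ?A x = y" if y: "y \<in> ell p" for y
  proof -
    have "\<exists>x\<in>ell p. tridiag (?s d) (?r d - l) x = parity_part d y" if "d \<le> 1" for d
      by (rule tridiag_surj[OF z(1) z(2) sn parity_part_ell[OF y that] p])
    then obtain u where u: "\<And>d. d \<le> 1 \<Longrightarrow> u d \<in> ell p"
      "\<And>d. d \<le> 1 \<Longrightarrow> tridiag (?s d) (?r d - l) (u d) = parity_part d y" by metis
    \<comment> \<open>The solutions for the two parities occupy disjoint index sets, so their sum
      has both of them as its parts.\<close>
    define x where "x = parity_spread 0 (u 0) + parity_spread 1 (u 1)"
    have x: "x \<in> ell p" unfolding x_def using u p by (intro ell_add parity_spread_ell) auto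
    have xu: "parity_part d x = u d" if "d \<le> 1" for d
    proof -
      have "parity_part d x = parity_part d (parity_spread 0 (u 0)) + parity_part d (parity_spread 1 (u 1))"
        by (simp add: x_def parity_part_def fun_eq_iff)
      also have "\<dots> = u d"
        using that u(1)[of 0] u(1)[of 1] by (auto simp: parity_part_spread ell_def le_Suc_eq)
      finally show ?thesis .
    qed
    have "?A x = y"
      by (rule parity_part_eqI) (use parity_part_T0[of x] x xu u(2) in \<open>simp add: ell_def\<close>)
    then show ?thesis using x by blast
  qed
qed

lemma T0_not_fredholm:
  fixes r1 r2 :: real and d :: nat
  assumes p: "1 < p" and d: "d \<le> 1" and s: "s1 > 0" "s2 > 0"
  defines "s \<equiv> if d = 1 then s1 else s2" and "r \<equiv> if d = 1 then r1 else r2"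
  assumes t: "t \<in> {r - 2 * s .. r + 2 * s}"
  shows "\<not> fredholm (ell p) (ell_norm p) (\<lambda>x. T0 r1 s1 r2 s2 x - of_real t *\<^sub>s\<^sub>q x)"
proof
  let ?A = "\<lambda>x. T0 r1 s1 r2 s2 x - of_real t *\<^sub>s\<^sub>q x"
  assume fr: "fredholm (ell p) (ell_norm p) ?A"
  have "s > 0" using s by (simp add: s_def)
  then obtain \<zeta> :: complex where \<zeta>: "s * \<zeta>\<^sup>2 + (r - complex_of_real t) * \<zeta> + s = 0" "cmod \<zeta> = 1"
    using characteristic_root_inside[OF _ t] by blast
  have \<zeta>0: "\<zeta> \<noteq> 0" using \<zeta>(2) by auto
  \<comment> \<open>These functionals are bounded in \<open>n\<close> on the range, by summation by
    parts, and will be shown unbounded on combinations of the \<open>v i\<close>.\<close>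
  define F where "F n y = (\<Sum>k=1..n. parity_part d y k * \<zeta> ^ k)" for n y
  \<comment> \<open>The exponents decrease strictly from 1 towards \<open>1 / p\<close> and stay
    above it: at most 1 for divergence of the partial sums, above \<open>1 / p\<close> for
    membership in \<open>ell p\<close>.\<close>
  define a where "a i = 1 / p + (1 - 1 / p) / real (i + 1)" for i
  \<comment> \<open>Division by the power of \<zeta> cancels the weight in \<open>F\<close>, so that
    \<open>F n (v i)\<close> is a partial sum of \<open>real k powr - a i\<close>. At
    \<open>k = 0\<close> the value is 0, because \<open>0 powr\<close> anything is 0.\<close>
  define w where "w i k = of_real (real k powr - a i) / \<zeta> ^ k" for i k
  define v where "v i = parity_spread d (w i)" for i
  have c: "0 < 1 - 1 / p" using p by simp
  have w: "w i \<in> ell p" for i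
  proof -
    have "cmod (w i k) powr p = real k powr (- a i * p)" for k
      using \<zeta>(2) by (simp add: w_def norm_divide norm_power powr_powr)
    moreover have "1 / p < a i" using c by (simp add: a_def)
    then have "- a i * p < - 1" using p by (simp add: field_simps)
    ultimately show ?thesis by (simp add: ell_def summable_real_powr_iff) (simp add: w_def)
  qed
  have v: "v i \<in> ell p" for i unfolding v_def by (rule parity_spread_ell[OF w d])
  have zero: "0 \<in> ?A ` ell p"
    by (rule image_eqI[of _ _ 0]) (simp_all add: T0_def seq_scale_def fun_eq_iff)
  have bdd: "\<exists>M. \<forall>n. cmod (F n y) \<le> M" if y: "y \<in> ?A ` ell p" for y
  proof -
    obtain x where x: "x \<in> ell p" "y = ?A x" using y by blast
    then have "parity_part d y = tridiag s (r - complex_of_real t) (parity_part d x)"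
      unfolding s_def r_def using parity_part_T0[OF _ d] by (simp add: ell_def)
    then show ?thesis
      using tridiag_partial_sums_bounded[OF \<zeta> parity_part_ell[OF x(1) d]] p by (simp add: F_def)
  qed
  have fd: "finite_dimensional_quotient (ell p) (?A ` ell p)" using fr by (simp add: fredholm_def)
  have Fadd: "F n (x + y) = F n x + F n y" for n x y
    by (simp add: F_def parity_part_def sum.distrib distrib_right)
  have Fscale: "F n (b *\<^sub>s\<^sub>q x) = b * F n x" for n b x
    by (simp add: F_def parity_part_def seq_scale_def sum_distrib_left mult.assoc)
  obtain N e M where e: "\<exists>i\<le>N. e i \<noteq> 0" "\<And>n. cmod (\<Sum>i\<le>N. e i * F n (v i)) \<le> M"
    using finite_dimensional_quotient_bounded_combination[where F = F and v = v, OF fd zero v Fadd Fscale bdd]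
    by metis
  have Fv: "F n (v i) = (\<Sum>k=1..n. of_real (real k powr - a i))" for n i
    using w[of i] d \<zeta>0 by (simp add: F_def v_def parity_part_spread ell_def) (simp add: w_def)
  have swap: "(\<Sum>i\<le>N. e i * F n (v i)) = (\<Sum>k=1..n. \<Sum>i\<le>N. e i * of_real (real k powr - a i))" for n
    unfolding Fv sum_distrib_left by (rule sum.swap)
  have "strict_antimono_on UNIV a"
  proof (rule monotone_onI)
    fix i j :: nat assume "i < j"
    then show "a j < a i"
      using c unfolding a_def by (intro add_strict_left_mono divide_strict_left_mono) auto
  qed
  moreover have "a i \<le> 1" for i
    using c divide_left_mono[of 1 "real (i + 1)" "1 - 1 / p"] by (simp add: a_def)
  ultimately show False
    using partial_sums_powr_combination_unbounded[OF _ _ e(1), of a M] e(2) unfolding swap by metis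
qed

theorem corollary3p8:
  fixes p r1 r2 s1 s2 :: real
  assumes "1 < p" and "r1 \<ge> 0" and "r2 \<ge> 0" and "s1 > 0" and "s2 > 0"
  shows "ess_spectrum (ell p) (ell_norm p) (T0 r1 s1 r2 s2) =
    complex_of_real ` {r1 - 2 * s1 .. r1 + 2 * s1} \<union>
    complex_of_real ` {r2 - 2 * s2 .. r2 + 2 * s2}"
proof (intro equalityI subsetI)
  fix l
  assume "l \<in> ess_spectrum (ell p) (ell_norm p) (T0 r1 s1 r2 s2)"
  then show "l \<in> complex_of_real ` {r1 - 2 * s1 .. r1 + 2 * s1} \<union>
    complex_of_real ` {r2 - 2 * s2 .. r2 + 2 * s2}"
    using T0_fredholm[of p s1 s2 l r1 r2] assms(1,4,5)
    unfolding ess_spectrum_def Un_iff mem_Collect_eq by (meson less_imp_le)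
next
  fix l
  assume "l \<in> complex_of_real ` {r1 - 2 * s1 .. r1 + 2 * s1} \<union>
    complex_of_real ` {r2 - 2 * s2 .. r2 + 2 * s2}"
  then show "l \<in> ess_spectrum (ell p) (ell_norm p) (T0 r1 s1 r2 s2)"
  proof
    assume "l \<in> complex_of_real ` {r1 - 2 * s1 .. r1 + 2 * s1}"
    then show ?thesis
      using T0_not_fredholm[of p 1 s1 s2 _ r1 r2] assms by (auto simp: ess_spectrum_def)
  next
    assume "l \<in> complex_of_real ` {r2 - 2 * s2 .. r2 + 2 * s2}"
    then show ?thesis
      using T0_not_fredholm[of p 0 s1 s2 _ r1 r2] assms by (auto simp: ess_spectrum_def)
  qed
qed

end
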